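(* Let $p$ be an odd prime. If $G$ is a finite $p$-group, then $P^*(G)$ is claw-free if and only if either $G$ is cyclic or $G$ has exponent $p$.
   Context: For a group $G$, the power graph $P(G)$ is the simple undirected graph whose vertices are the elements of $G$, two distinct vertices $u,v$ being adjacent if and only if one of them is a power of the other (equivalently, one of $\langle u\rangle,\langle v\rangle$ is contained in the other). The reduced power graph $P^*(G)$ is the subgraph of $P(G)$ induced by the non-identity elements. A graph is claw-free if it has no induced subgraph isomorphic to the complete bipartite graph $K_{1,3}$. *)

theory Defs
  imports
    "HOL-Algebra.Elementary_Groups"
    "HOL-Algebra.Multiplicative_Group"
    "HOL-Computational_Algebra.Primes"
    "Graph_Theory.Graph_Theory"
begin

text \<open>
  Undirected graphs are symmetric digraphs, as in \<open>Graph_Theory\<close>: an edge between \<open>u\<close> and \<open>v\<close> is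
  the pair of arcs \<open>(u, v)\<close>, \<open>(v, u)\<close>.  Powers have integer exponents, so that \<open>v\<close> is a power
  of \<open>u\<close> iff \<open>\<langle>v\<rangle> \<subseteq> \<langle>u\<rangle>\<close> in every group.
\<close>

definition power_graph :: "('a, 'm) monoid_scheme \<Rightarrow> 'a pair_pre_digraph" where
  "power_graph G =
    \<lparr> pverts = carrier G,
      parcs = {(u, v). u \<in> carrier G \<and> v \<in> carrier G \<and> u \<noteq> v \<and>
        ((\<exists>k::int. v = u [^]\<^bsub>G\<^esub> k) \<or> (\<exists>k::int. u = v [^]\<^bsub>G\<^esub> k))} \<rparr>"

definition reduced_power_graph :: "('a, 'm) monoid_scheme \<Rightarrow> ('a, 'a \<times> 'a) pre_digraph" where
  "reduced_power_graph G = with_proj (power_graph G) \<restriction> (carrier G - {\<one>\<^bsub>G\<^esub>})"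

text \<open>
  \<open>K\<^bsub>1,3\<^esub>\<close> is a predicate on graphs, invariant under isomorphism.
\<close>

definition claw_free :: "('a, 'b) pre_digraph \<Rightarrow> bool" where
  "claw_free \<Gamma> \<longleftrightarrow> \<not> (\<exists>H. induced_subgraph H \<Gamma> \<and> K\<^bsub>1,3\<^esub> H)"

text \<open>
  The value 0 stands for infinite exponent.
\<close>

definition group_exponent :: "('a, 'm) monoid_scheme \<Rightarrow> nat" where
  "group_exponent G =
    (if \<exists>n>0. \<forall>x\<in>carrier G. x [^]\<^bsub>G\<^esub> (n::nat) = \<one>\<^bsub>G\<^esub>
     then LEAST n. 0 < n \<and> (\<forall>x\<in>carrier G. x [^]\<^bsub>G\<^esub> n = \<one>\<^bsub>G\<^esub>)
     else 0)"

text \<open>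
  The library's \<open>induced_subgraph\<close> can only hold inside a well-formed digraph, so \<open>claw_free\<close>
  would be vacuous for an ill-formed one; the following rules that out.
\<close>

lemma pair_bidirected_digraph_power_graph: "pair_bidirected_digraph (power_graph G)"
  by unfold_locales (auto simp: power_graph_def symmetric_def intro!: symI)

lemma wf_digraph_reduced_power_graph: "wf_digraph (reduced_power_graph G)"
  by unfold_locales (auto simp: reduced_power_graph_def induce_subgraph_def)

lemma graph_reduced_power_graph:
  assumes "finite (carrier G)"
  shows "graph (reduced_power_graph G)"
proof -
  have "finite (parcs (power_graph G))"
    by (rule finite_subset[of _ "carrier G \<times> carrier G"]) (auto simp: power_graph_def assms)
  then show ?thesis
    using assms
    by unfold_locales
      (auto simp: reduced_power_graph_def induce_subgraph_def power_graph_def arc_to_ends_def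
        symmetric_conv)
qed

end

theory Submission
  imports Defs "HOL-Algebra.Group_Action"
begin

text \<open>
  In the reduced power graph of a \<open>p\<close>-group, elements of equal order are adjacent only if they generate the
  same subgroup, and any two vertices in a common cyclic subgroup are adjacent. The second
  observation makes the graph complete if the group is cyclic; if the exponent is \<open>p\<close>, the neighbours
  of a vertex all lie in the cyclic subgroup that it generates. In both cases there is no claw
  (\<open>claw_free_if_neighbours_in_cyclic\<close>).

  Conversely, let the graph be claw-free and let some element have order at least \<open>p\<^sup>2\<close>. Three cyclic
  subgroups of equal order with a common smaller non-trivial subgroup cannot be pairwise distinct
  (\<open>claw_free_three\<close>). This is used twice. Applied to \<open>x\<close>, \<open>x \<otimes> y\<close>, \<open>x \<otimes> y\<^sup>2\<close> for \<open>x\<close> of order \<open>p\<^sup>2\<close>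
  and \<open>y\<close> of order \<open>p\<close>, it puts \<open>y\<close> into the subgroup of \<open>x\<close>, provided that the commutator of \<open>x\<close>
  and \<open>y\<close> commutes with both and has trivial \<open>p\<close>-th power (\<open>order_p_mem_generate\<close>). Taking \<open>y\<close> central, every cyclic subgroup of order
  \<open>p\<^sup>2\<close> has a central subgroup of order \<open>p\<close>. Applied to three conjugates of \<open>u\<close>, it then shows
  that the cyclic subgroup \<open>\<langle>u\<rangle>\<close> is normal whenever \<open>u\<close> has order at least \<open>p\<^sup>2\<close>
  (\<open>normal_generate_if_claw_free\<close>).

  Now choose \<open>u\<close> of maximal order. Normality makes the relevant commutators central of order
  dividing \<open>p\<close>, so that for odd \<open>p\<close> the map taking \<open>p\<close>-th powers is multiplicative on the products
  that occur. Hence all elements of order \<open>p\<close> lie in \<open>\<langle>u\<rangle>\<close>, and any other element differs from an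
  element of \<open>\<langle>u\<rangle>\<close> with the same \<open>p\<close>-th power by an element of order dividing \<open>p\<close>. So \<open>u\<close> generates
  the group (\<open>claw_free_imp_cyclic\<close>).
\<close>

section \<open>Claws in graphs\<close>

text \<open>
  The centre of a star cannot be one of its own leaves because the graph has no loops, so an
  induced \<open>K\<^bsub>1,3\<^esub>\<close> amounts to three pairwise non-adjacent neighbours of one vertex.
\<close>

lemma claw_free_iff:
  assumes "graph \<Gamma>"
  shows "claw_free \<Gamma> \<longleftrightarrow>
    (\<forall>a V. card V = 3 \<and> (\<forall>v\<in>V. a \<rightarrow>\<^bsub>\<Gamma>\<^esub> v) \<longrightarrow> (\<exists>u\<in>V. \<exists>v\<in>V. u \<rightarrow>\<^bsub>\<Gamma>\<^esub> v))"
proof -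
  interpret graph \<Gamma> by (fact assms)
  have "\<exists>a V. card V = 3 \<and> (\<forall>v\<in>V. a \<rightarrow>\<^bsub>\<Gamma>\<^esub> v) \<and> \<not> (\<exists>u\<in>V. \<exists>v\<in>V. u \<rightarrow>\<^bsub>\<Gamma>\<^esub> v)"
    if H: "induced_subgraph H \<Gamma>" and K: "K\<^bsub>1,3\<^esub> H" for H
  proof -
    from K obtain U V where UV: "verts H = U \<union> V" "U \<inter> V = {}" "card U = 1" "card V = 3"
      "arcs_ends H = U \<times> V \<union> V \<times> U"
      unfolding complete_bipartite_digraph_def by auto
    then obtain a where a: "U = {a}" by (auto simp: card_1_singleton_iff)
    have th: "tail H = tail \<Gamma>" "head H = head \<Gamma>" and arcs: "arcs H \<subseteq> arcs \<Gamma>"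
      using H by (auto simp: induced_subgraph_def subgraph_def compatible_def)
    have "a \<rightarrow>\<^bsub>\<Gamma>\<^esub> v" if "v \<in> V" for v
    proof -
      have "(a, v) \<in> arcs_ends H" using that UV(5) a by auto
      then show ?thesis using th arcs by (auto simp: arcs_ends_def arc_to_ends_def)
    qed
    moreover have "\<not> u \<rightarrow>\<^bsub>\<Gamma>\<^esub> v" if "u \<in> V" "v \<in> V" for u v
    proof
      assume "u \<rightarrow>\<^bsub>\<Gamma>\<^esub> v"
      then have "(u, v) \<in> arcs_ends H"
        using that H UV(1) th by (auto simp: arcs_ends_def arc_to_ends_def induced_subgraph_def)
      then show False using that UV(2,5) by auto
    qed
    ultimately show ?thesis using UV(4) by blast
  qed
  moreover have "\<exists>H. induced_subgraph H \<Gamma> \<and> K\<^bsub>1,3\<^esub> H"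
    if V: "card V = 3" "\<forall>v\<in>V. a \<rightarrow>\<^bsub>\<Gamma>\<^esub> v" "\<forall>u\<in>V. \<forall>v\<in>V. \<not> u \<rightarrow>\<^bsub>\<Gamma>\<^esub> v" for a V
  proof (intro exI conjI)
    let ?H = "\<Gamma> \<restriction> (insert a V)"
    have "V \<noteq> {}" using V(1) by auto
    then have sub: "insert a V \<subseteq> verts \<Gamma>" using V(2) adj_in_verts by auto
    have aV: "a \<notin> V" using V(2,3) by blast
    show ind: "induced_subgraph ?H \<Gamma>" by (rule induced_induce[OF sub])
    have "graph ?H"
      using digraph.graphI[OF digraphI_induced[OF ind]] induced_graph_imp_symmetric[OF sym_arcs ind] by blast
    moreover have "arcs_ends ?H = {a} \<times> V \<union> V \<times> {a}"
    proof -
      have "arcs_ends ?H = {(u, v). u \<rightarrow>\<^bsub>\<Gamma>\<^esub> v \<and> u \<in> insert a V \<and> v \<in> insert a V}"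
        by (auto simp: arcs_ends_def arc_to_ends_def image_iff)
      also have "\<dots> = {a} \<times> V \<union> V \<times> {a}"
        using V(2,3) aV adj_not_same by (auto intro: graph_symmetric)
      finally show ?thesis .
    qed
    ultimately show "K\<^bsub>1,3\<^esub> ?H"
      unfolding complete_bipartite_digraph_def
      by (intro conjI exI[of _ "{a}"] exI[of _ V]) (use V(1) aV in simp_all)
  qed
  ultimately have "(\<exists>H. induced_subgraph H \<Gamma> \<and> K\<^bsub>1,3\<^esub> H) \<longleftrightarrow>
    (\<exists>a V. card V = 3 \<and> (\<forall>v\<in>V. a \<rightarrow>\<^bsub>\<Gamma>\<^esub> v) \<and> \<not> (\<exists>u\<in>V. \<exists>v\<in>V. u \<rightarrow>\<^bsub>\<Gamma>\<^esub> v))"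
    by meson
  then show ?thesis unfolding claw_free_def by meson
qed

section \<open>Cyclic subgroups and powers of products\<close>

context group begin

lemma generate_singleton_subset:
  assumes "a \<in> carrier G" "b \<in> generate G {a}"
  shows "generate G {b} \<subseteq> generate G {a}"
  using assms generate_is_subgroup[of "{a}"] generate_subgroup_incl[of "{b}" "generate G {a}"] by auto

text \<open>
  A finite cyclic group has only one subgroup of each order, and these subgroups are nested as
  their orders divide. With \<open>v\<close> the \<open>j\<close>-th power of a generator of order \<open>N\<close>, the subgroup of \<open>v\<close>
  consists of the powers whose exponent is divisible by \<open>gcd N j\<close>, by Bezout.
\<close>

lemma ord_dvd_imp_mem_generate:
  assumes g: "g \<in> carrier G" and fin: "ord g \<noteq> 0"
    and u: "u \<in> generate G {g}" and v: "v \<in> generate G {g}" and dvd: "ord u dvd ord v"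
  shows "u \<in> generate G {v}"
proof -
  obtain i j :: int where i: "u = g [^] i" and j: "v = g [^] j"
    using u v g by (auto simp: generate_pow)
  have uv: "u \<in> carrier G" "v \<in> carrier G" using g i j by auto
  define N where "N = int (ord g)"
  have N: "N > 0" using fin by (simp add: N_def)
  define d where "d = gcd N j"
  have d: "d > 0" using N by (simp add: d_def)
  obtain m where m: "N = d * m" unfolding d_def by (meson dvdE gcd_dvd1)
  have m0: "m > 0" using m N d by (metis zero_less_mult_pos)
  have "N dvd j * m" unfolding m using d_def by (intro mult_dvd_mono) auto
  then have "v [^] m = \<one>" using g by (simp add: j int_pow_pow int_pow_eq_id N_def)
  then have "int (ord v) dvd m" using int_pow_eq_id uv by blast
  with dvd have "int (ord u) dvd m" by (meson dvd_trans int_dvd_int_iff)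
  then have "u [^] m = \<one>" using int_pow_eq_id uv by blast
  then have "N dvd i * m" using g by (simp add: i int_pow_pow int_pow_eq_id N_def)
  then have "d dvd i" using m m0 by simp
  then obtain q where q: "i = d * q" by auto
  obtain s t where "s * N + t * j = d" using bezout_int d_def by metis
  then have "i = N * (s * q) + j * (t * q)" using q by (auto simp: algebra_simps)
  then have "u = (g [^] N) [^] (s * q) \<otimes> v [^] (t * q)"
    using g by (simp add: i j int_pow_mult int_pow_pow)
  also have "g [^] N = \<one>" using g by (simp add: int_pow_eq_id N_def)
  finally have "u = v [^] (t * q)" using uv by simp
  then show ?thesis using uv by (auto simp: generate_pow)
qed

lemma nat_pow_mem_generate:
  assumes "a \<in> carrier G" "b \<in> generate G {a}"
  shows "b [^] (k::nat) \<in> generate G {a}"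
  using assms generate_is_subgroup[of "{a}"] subgroup_int_pow_closed[of "generate G {a}" b "int k"]
  by (simp add: int_pow_int)

lemma mem_generate_square_if_odd_ord:
  assumes "y \<in> carrier G" "odd (ord y)"
  shows "y \<in> generate G {y [^] (2::nat)}"
proof (rule ord_dvd_imp_mem_generate[where g = y])
  show "ord y dvd ord (y [^] (2::nat))" using assms
    by (simp add: ord_pow_gen)
  show "y [^] (2::nat) \<in> generate G {y}"
    using assms(1) by (intro nat_pow_mem_generate) (auto intro: generate.incl)
  show "ord y \<noteq> 0" using assms(2) by (metis even_zero)
qed (use assms in \<open>auto intro: generate.incl\<close>)

lemma generate_singleton_sym:
  assumes "finite (carrier G)" "a \<in> carrier G" "b \<in> generate G {a}" "ord a = ord b"
  shows "a \<in> generate G {b}"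
proof (rule ord_dvd_imp_mem_generate[where g = a])
  show "ord a \<noteq> 0" using ord_ge_1[OF assms(1,2)] by simp
qed (use assms in \<open>auto intro: generate.incl\<close>)

lemma generate_singleton_commute:
  assumes "a \<in> carrier G" "b \<in> generate G {a}" "c \<in> generate G {a}"
  shows "b \<otimes> c = c \<otimes> b"
  using assms by (auto simp: generate_pow simp flip: int_pow_mult) (simp add: add.commute int_pow_mult)

lemma central_generate:
  assumes "finite (carrier G)" "a \<in> carrier G" "\<forall>g\<in>carrier G. g \<otimes> a = a \<otimes> g"
    and "b \<in> generate G {a}"
  shows "\<forall>g\<in>carrier G. g \<otimes> b = b \<otimes> g"
proof
  fix g assume g: "g \<in> carrier G"
  obtain k :: nat where "b = a [^] k"
    using assms(4) generate_pow_on_finite_carrier[OF assms(1,2)] by auto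
  then show "g \<otimes> b = b \<otimes> g"
    using assms(2,3) g by (metis group_commutes_pow)
qed

lemma nat_pow_mult_twisted_commute:
  assumes "x \<in> carrier G" "y \<in> carrier G" "w \<in> carrier G"
    and "w \<otimes> y = y \<otimes> w" "y \<otimes> x = w \<otimes> (x \<otimes> y)"
  shows "y [^] (k::nat) \<otimes> x = w [^] k \<otimes> (x \<otimes> y [^] k)"
proof (induction k)
  case (Suc k)
  have wy: "y \<otimes> w [^] k = w [^] k \<otimes> y"
    using assms by (metis group_commutes_pow)
  have "y [^] Suc k \<otimes> x = y \<otimes> (y [^] k \<otimes> x)"
    using assms(1,2) by (simp only: nat_pow_Suc2 m_assoc nat_pow_closed)
  also have "\<dots> = (y \<otimes> w [^] k) \<otimes> (x \<otimes> y [^] k)"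
    using assms(1-3) by (simp add: Suc.IH m_assoc)
  also have "\<dots> = w [^] k \<otimes> ((y \<otimes> x) \<otimes> y [^] k)"
    unfolding wy using assms(1-3) by (simp add: m_assoc)
  also have "\<dots> = w [^] Suc k \<otimes> (x \<otimes> (y \<otimes> y [^] k))"
    unfolding assms(5) using assms(1-3) by (simp add: m_assoc)
  also have "y \<otimes> y [^] k = y [^] Suc k"
    using assms(2) by (simp only: nat_pow_Suc2)
  finally show ?case .
qed (use assms in simp)

text \<open>
  Here \<open>w\<close> is the commutator of \<open>y\<close> and \<open>x\<close>, central in the subgroup that they generate. Sorting
  \<open>k\<close> copies of \<open>x \<otimes> y\<close> moves a \<open>y\<close> past an \<open>x\<close> once for each pair of copies, at the price of a
  factor \<open>w\<close> each time.
\<close>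

lemma nat_pow_mult_twisted:
  assumes "x \<in> carrier G" "y \<in> carrier G" "w \<in> carrier G"
    and "w \<otimes> x = x \<otimes> w" "w \<otimes> y = y \<otimes> w" "y \<otimes> x = w \<otimes> (x \<otimes> y)"
  shows "(x \<otimes> y) [^] (k::nat) = w [^] (k * (k - 1) div 2) \<otimes> (x [^] k \<otimes> y [^] k)"
proof (induction k)
  case (Suc k)
  let ?T = "k * (k - 1) div 2"
  have T: "?T + k = Suc k * (Suc k - 1) div 2"
    by (cases k) auto
  have wx: "x [^] k \<otimes> w [^] k = w [^] k \<otimes> x [^] k"
    using assms(1,3,4) by (metis group_commutes_pow nat_pow_closed)
  have "(x \<otimes> y) [^] Suc k = w [^] ?T \<otimes> (x [^] k \<otimes> y [^] k) \<otimes> (x \<otimes> y)"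
    by (simp add: Suc.IH)
  also have "\<dots> = w [^] ?T \<otimes> (x [^] k \<otimes> ((y [^] k \<otimes> x) \<otimes> y))"
    using assms(1-3) by (simp add: m_assoc)
  also have "\<dots> = w [^] ?T \<otimes> ((x [^] k \<otimes> w [^] k) \<otimes> (x \<otimes> (y [^] k \<otimes> y)))"
    unfolding nat_pow_mult_twisted_commute[OF assms(1-3,5,6)]
    using assms(1-3) by (simp add: m_assoc)
  also have "\<dots> = (w [^] ?T \<otimes> w [^] k) \<otimes> ((x [^] k \<otimes> x) \<otimes> (y [^] k \<otimes> y))"
    unfolding wx using assms(1-3) by (simp add: m_assoc)
  also have "w [^] ?T \<otimes> w [^] k = w [^] (Suc k * (Suc k - 1) div 2)"
    using assms(3) by (simp only: nat_pow_mult T)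
  finally show ?case by simp
qed (use assms in simp)

text \<open>
  For odd \<open>p\<close> the number of pairs among \<open>p\<close> copies is a multiple of \<open>p\<close>, so the commutators cancel.
  This fails for \<open>p = 2\<close>, as \<open>x \<otimes> y\<close> in the dihedral group of order 8 shows when \<open>x\<close> and \<open>y\<close> are
  non-commuting reflections.
\<close>

lemma nat_pow_odd_mult_twisted:
  assumes "x \<in> carrier G" "y \<in> carrier G" "w \<in> carrier G"
    and "w \<otimes> x = x \<otimes> w" "w \<otimes> y = y \<otimes> w" "y \<otimes> x = w \<otimes> (x \<otimes> y)"
    and "odd p" "w [^] (p::nat) = \<one>"
  shows "(x \<otimes> y) [^] p = x [^] p \<otimes> y [^] p"
proof -
  have "p * (p - 1) div 2 = p * ((p - 1) div 2)"
    using \<open>odd p\<close> by (simp add: div_mult_swap)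
  then have "w [^] (p * (p - 1) div 2) = \<one>"
    using assms(3,8) by (simp flip: nat_pow_pow)
  then show ?thesis
    using nat_pow_mult_twisted[OF assms(1-6), of p] assms(1,2) by simp
qed

lemma nat_pow_conj:
  assumes "g \<in> carrier G" "b \<in> carrier G"
  shows "(g \<otimes> b \<otimes> inv g) [^] (k::nat) = g \<otimes> b [^] k \<otimes> inv g"
proof (induction k)
  case (Suc k)
  have "(g \<otimes> b [^] k \<otimes> inv g) \<otimes> (g \<otimes> b \<otimes> inv g) = g \<otimes> b [^] k \<otimes> (inv g \<otimes> g) \<otimes> (b \<otimes> inv g)"
    using assms by (simp only: m_assoc m_closed inv_closed nat_pow_closed)
  also have "\<dots> = g \<otimes> b [^] Suc k \<otimes> inv g"
    using assms by (simp add: m_assoc)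
  finally show ?case by (simp add: Suc.IH)
qed (use assms in simp)

lemma ord_conj:
  assumes "g \<in> carrier G" "b \<in> carrier G"
  shows "ord (g \<otimes> b \<otimes> inv g) = ord b"
proof -
  have "g \<otimes> h \<otimes> inv g = \<one> \<longleftrightarrow> h = \<one>" if "h \<in> carrier G" for h
    using that assms by (metis conjugation_is_inj inv_closed l_inv one_closed r_inv r_one)
  then show ?thesis
    using assms by (simp add: ord_unique nat_pow_conj pow_eq_id)
qed

end

section \<open>Claws in reduced power graphs\<close>

context group begin

lemma reduced_power_graph_adjacent_iff:
  "u \<rightarrow>\<^bsub>reduced_power_graph G\<^esub> v \<longleftrightarrow>
    u \<in> carrier G - {\<one>} \<and> v \<in> carrier G - {\<one>} \<and> u \<noteq> v \<and>
    (v \<in> generate G {u} \<or> u \<in> generate G {v})"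
  by (auto simp: reduced_power_graph_def power_graph_def arcs_ends_def arc_to_ends_def image_iff
    generate_pow)

text \<open>
  Elements of equal order are adjacent only if they generate the same subgroup. A common
  non-trivial power \<open>z\<close> of smaller order is therefore the centre of a claw as soon as the three
  subgroups are distinct.
\<close>

lemma claw_free_three:
  assumes fin: "finite (carrier G)" and cf: "claw_free (reduced_power_graph G)"
    and bcd: "b \<in> carrier G" "c \<in> carrier G" "d \<in> carrier G"
    and ords: "ord c = ord b" "ord d = ord b"
    and z: "z \<in> carrier G" "z \<noteq> \<one>" "ord z < ord b"
      "z \<in> generate G {b}" "z \<in> generate G {c}" "z \<in> generate G {d}"
  shows "c \<in> generate G {b} \<or> d \<in> generate G {b} \<or> d \<in> generate G {c}"
proof (rule ccontr)
  assume no: "\<not> ?thesis"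
  have self: "a \<in> generate G {a}" for a by (auto intro: generate.incl)
  have sym: "u \<in> generate G {v}" if "v \<in> generate G {u}" "u \<in> {b, c, d}" "v \<in> {b, c, d}" for u v
    using generate_singleton_sym[OF fin, of u v] that bcd ords by auto
  have adj: "z \<rightarrow>\<^bsub>reduced_power_graph G\<^esub> v" if v: "v \<in> {b, c, d}" for v
  proof -
    have "ord v = ord b" "v \<in> carrier G" using v bcd ords by auto
    moreover have "v \<noteq> \<one>"
      using \<open>ord v = ord b\<close> z(3) ord_ge_1[OF fin z(1)] by auto
    moreover have "z \<in> generate G {v}" using v z by auto
    ultimately show ?thesis
      using z by (auto simp: reduced_power_graph_adjacent_iff)
  qed
  have "c \<noteq> b" "d \<noteq> b" "d \<noteq> c" using no self by metis+
  then have "card {b, c, d} = 3" by auto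
  then have "\<exists>u\<in>{b, c, d}. \<exists>v\<in>{b, c, d}. u \<rightarrow>\<^bsub>reduced_power_graph G\<^esub> v"
    using cf adj claw_free_iff[OF graph_reduced_power_graph[OF fin]] by meson
  then obtain u v where uv: "u \<in> {b, c, d}" "v \<in> {b, c, d}" "u \<rightarrow>\<^bsub>reduced_power_graph G\<^esub> v"
    by (elim bexE)
  from uv(3) have "u \<noteq> v" "v \<in> generate G {u} \<or> u \<in> generate G {v}"
    unfolding reduced_power_graph_adjacent_iff by blast+
  then have "u \<noteq> v" "v \<in> generate G {u}" "u \<in> generate G {v}"
    using sym[OF _ uv(1,2)] sym[OF _ uv(2,1)] by blast+
  then show False using uv(1,2) no by auto
qed

text \<open>
  The conjugates of \<open>b\<close> by \<open>\<one>\<close>, \<open>g\<close> and \<open>g \<otimes> g\<close> all have the central element \<open>z\<close> as a power, so two of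
  them generate the same subgroup, and \<open>g\<close> or \<open>g \<otimes> g\<close> normalizes the subgroup of \<open>b\<close>. In a group
  of odd order \<open>g\<close> is a power of its square, so \<open>g\<close> normalizes it in either case.
\<close>

lemma normal_generate_if_claw_free:
  assumes fin: "finite (carrier G)" and cf: "claw_free (reduced_power_graph G)"
    and odd: "odd (order G)" and b: "b \<in> carrier G"
    and z: "z \<noteq> \<one>" "z \<in> generate G {b}" "ord z < ord b"
    and central: "\<forall>g\<in>carrier G. g \<otimes> z = z \<otimes> g"
  shows "generate G {b} \<lhd> G"
proof (rule normal_invI)
  show "subgroup (generate G {b}) G" using b by (simp add: generate_is_subgroup)
next
  fix g h assume g: "g \<in> carrier G" and h: "h \<in> generate G {b}"
  let ?conj = "\<lambda>g. g \<otimes> b \<otimes> inv g"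
  have zG: "z \<in> carrier G" using z(2) b by (auto simp: generate_pow)
  have pow: "\<exists>k::nat. v = a [^] k" if "v \<in> generate G {a}" "a \<in> carrier G" for v a
    using that generate_pow_on_finite_carrier[OF fin] by auto
  have z_conj: "z \<in> generate G {?conj g}" if g: "g \<in> carrier G" for g
  proof -
    obtain k :: nat where k: "z = b [^] k" using pow z(2) b by blast
    have "z = z \<otimes> g \<otimes> inv g" using g zG by (simp add: m_assoc)
    also have "\<dots> = g \<otimes> b [^] k \<otimes> inv g" using central g k by simp
    also have "\<dots> = ?conj g [^] k" using g b by (simp add: nat_pow_conj)
    also have "\<dots> \<in> generate G {?conj g}"
      using g b by (intro nat_pow_mem_generate) (auto intro: generate.incl)
    finally show ?thesis .
  qed
  have conj_mult: "?conj (g \<otimes> h) \<in> generate G {b}"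
    if gh: "g \<in> carrier G" "h \<in> carrier G" "?conj g \<in> generate G {b}" "?conj h \<in> generate G {b}" for g h
  proof -
    obtain k :: nat where k: "?conj h = b [^] k" using pow gh(4) b by blast
    have "?conj (g \<otimes> h) = g \<otimes> ?conj h \<otimes> inv g"
      using gh(1,2) b by (simp add: m_assoc inv_mult_group)
    also have "\<dots> = ?conj g [^] k" using gh(1) b by (simp add: k nat_pow_conj)
    also have "\<dots> \<in> generate G {b}" using b gh(3) by (rule nat_pow_mem_generate)
    finally show ?thesis .
  qed
  have conj_pow: "?conj (g [^] k) \<in> generate G {b}"
    if "g \<in> carrier G" "?conj g \<in> generate G {b}" for g and k :: nat
  proof (induction k)
    case (Suc k)
    then show ?case using conj_mult[of "g [^] k" g] that by simp
  qed (use b in \<open>auto intro: generate.incl\<close>)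
  have "?conj g \<in> generate G {b}"
  proof -
    have g2: "g \<otimes> g \<in> carrier G" using g by simp
    have two: "?conj (g \<otimes> g) = g \<otimes> ?conj g \<otimes> inv g"
      using g b by (simp add: m_assoc inv_mult_group)
    consider "?conj g \<in> generate G {b}" | "?conj (g \<otimes> g) \<in> generate G {b}"
      | "?conj (g \<otimes> g) \<in> generate G {?conj g}"
      using claw_free_three[OF fin cf b _ _ _ _ zG z(1,3,2) z_conj[OF g] z_conj[OF g2]]
        g g2 b by (auto simp: ord_conj)
    then show ?thesis
    proof cases
      case 2
      \<comment> \<open>\<open>g \<otimes> g\<close> normalizes the subgroup, hence so does its power \<open>g\<close>.\<close>
      have "odd (ord g)" using odd ord_dvd_group_order[OF g] by (metis dvd_trans)
      then have "g \<in> generate G {g [^] (2::nat)}" using g mem_generate_square_if_odd_ord by blast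
      then obtain k :: nat where k: "g = (g \<otimes> g) [^] k"
        using pow g by (metis nat_pow_closed nat_pow_Suc2 nat_pow_0 numeral_2_eq_2 r_one)
      show ?thesis using conj_pow[OF g2 2, of k] k by simp
    next
      case 3
      \<comment> \<open>Cancelling one conjugation by \<open>g\<close> gives back the first case.\<close>
      then obtain k :: nat where "?conj (g \<otimes> g) = ?conj g [^] k"
        using pow g b by blast
      then have "g \<otimes> ?conj g \<otimes> inv g = g \<otimes> b [^] k \<otimes> inv g"
        using two g b by (simp add: nat_pow_conj)
      then have "?conj g = b [^] k" using g b by simp
      then show ?thesis using b by (auto intro: nat_pow_mem_generate generate.incl)
    qed
  qed
  moreover obtain k :: nat where "h = b [^] k" using pow h b by blast
  ultimately show "g \<otimes> h \<otimes> inv g \<in> generate G {b}"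
    using g b nat_pow_mem_generate[of b "?conj g" k] by (simp add: nat_pow_conj)
qed

end

section \<open>Finite p-groups\<close>

locale finite_p_group = group +
  fixes p n :: nat
  assumes prime_p: "prime p" and finite_carrier: "finite (carrier G)"
    and order_eq: "order G = p ^ n"
begin

lemma ord_eq_prime_power:
  assumes "x \<in> carrier G"
  shows "\<exists>k. ord x = p ^ k"
  using ord_dvd_group_order[OF assms] prime_p order_eq by (metis divides_primepow_nat)

lemma ord_nonzero: "x \<in> carrier G \<Longrightarrow> ord x \<noteq> 0"
  using ord_eq_prime_power prime_p by (metis power_not_zero not_prime_0)

lemma ord_dvd_linear:
  assumes "x \<in> carrier G" "y \<in> carrier G"
  shows "ord x dvd ord y \<or> ord y dvd ord x"
  using ord_eq_prime_power[OF assms(1)] ord_eq_prime_power[OF assms(2)]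
  by (metis le_imp_power_dvd linear)

text \<open>
  In the class equation the class of \<open>\<one>\<close> has one element. If every other class had more than one
  element, their sizes would be divisible by \<open>p\<close>, and the order of the group would be
  \<open>1\<close> modulo \<open>p\<close>.
\<close>

lemma exists_central_nontrivial:
  assumes "carrier G \<noteq> {\<one>}"
  shows "\<exists>c\<in>carrier G. c \<noteq> \<one> \<and> (\<forall>g\<in>carrier G. g \<otimes> c = c \<otimes> g)"
proof (rule ccontr)
  assume no: "\<not> ?thesis"
  define \<phi> where "\<phi> = (\<lambda>g. \<lambda>h \<in> carrier G. g \<otimes> h \<otimes> inv g)"
  interpret act: group_action G "carrier G" \<phi>
    unfolding \<phi>_def by (rule action_by_conjugation)
  have dvd: "p dvd card (orbit G \<phi> x)" if x: "x \<in> carrier G" "x \<noteq> \<one>" for x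
  proof -
    obtain k where k: "card (orbit G \<phi> x) = p ^ k"
      using act.orbit_stabilizer_theorem[OF x(1)] order_eq prime_p
      by (metis divides_primepow_nat dvd_triv_left)
    have "k \<noteq> 0"
    proof
      assume "k = 0"
      then have "card (orbit G \<phi> x) = 1" using k by simp
      then obtain a where a: "orbit G \<phi> x = {a}" by (auto simp: card_1_singleton_iff)
      have "x \<in> orbit G \<phi> x" using act.orbit_refl x(1) by simp
      then have "orbit G \<phi> x = {x}" using a by auto
      then have "g \<otimes> x \<otimes> inv g = x" if "g \<in> carrier G" for g
        using that x(1) unfolding orbit_def \<phi>_def by auto
      then have "g \<otimes> x = x \<otimes> g" if "g \<in> carrier G" for g
        using that x(1) by (metis inv_solve_right' m_closed)
      then show False using no x by blast
    qed
    then show ?thesis using k by simp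
  qed
  have one: "orbit G \<phi> \<one> = {\<one>}"
    unfolding orbit_def \<phi>_def by (auto intro!: exI[of _ \<one>])
  have fin: "finite (orbits G (carrier G) \<phi>)"
    unfolding orbits_def using finite_carrier by auto
  have one_mem: "{\<one>} \<in> orbits G (carrier G) \<phi>"
    unfolding orbits_def using one by auto
  have "order G = card (\<Union> (orbits G (carrier G) \<phi>))"
    by (simp add: act.orbits_coverture order_def)
  also have "\<dots> = (\<Sum>A\<in>orbits G (carrier G) \<phi>. card A)"
  proof (rule card_Union_disjoint)
    show "disjoint (orbits G (carrier G) \<phi>)"
      using act.disjoint_union by (auto simp: disjoint_def pairwise_def disjnt_def)
    show "finite A" if "A \<in> orbits G (carrier G) \<phi>" for A
      using that act.orbits_coverture finite_carrier by (metis Union_upper finite_subset)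
  qed
  also have "\<dots> = 1 + (\<Sum>A\<in>orbits G (carrier G) \<phi> - {{\<one>}}. card A)"
    using fin one_mem by (simp add: sum.remove)
  finally have eq: "order G = 1 + (\<Sum>A\<in>orbits G (carrier G) \<phi> - {{\<one>}}. card A)" .
  have "p dvd (\<Sum>A\<in>orbits G (carrier G) \<phi> - {{\<one>}}. card A)"
    using dvd one by (intro dvd_sum) (auto simp: orbits_def)
  moreover have "p dvd order G"
  proof -
    have "card (carrier G) \<noteq> 1"
      using assms by (metis card_1_singletonE one_closed singletonD)
    then have "n \<noteq> 0" using order_eq by (auto simp: order_def)
    then show ?thesis by (simp add: order_eq)
  qed
  ultimately have "p dvd 1" using eq by (metis dvd_add_left_iff)
  then show False using prime_p by simp
qed

lemma ord_power_prime_power: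
  assumes "x \<in> carrier G" "ord x = p ^ k" "j \<le> k"
  shows "ord (x [^] (p ^ j)) = p ^ (k - j)"
  using assms prime_p ord_pow[OF assms(1), of "p ^ j"]
  by (auto simp: le_imp_power_dvd power_diff prime_gt_0_nat)

end

section \<open>Claw-free p-groups with an element of order at least the square of p\<close>

context finite_p_group begin

text \<open>
  Otherwise \<open>x\<close>, \<open>x \<otimes> y\<close> and \<open>x \<otimes> y\<^sup>2\<close> are the leaves of a claw around \<open>x\<^sup>p\<close>: the twisted power formula
  gives all three the same \<open>p\<close>-th power, and any two of them generating the same cyclic group would
  put \<open>x\<close> and \<open>y\<close> into it, where the subgroup of order \<open>p\<close> already lies in that of \<open>x\<close>. The
  commutator \<open>w\<close> is left general so that the lemma serves both for central \<open>y\<close>, with \<open>w = \<one>\<close>, and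
  for a \<open>y\<close> that acts non-trivially on the subgroup of \<open>x\<close>.
\<close>

lemma order_p_mem_generate:
  assumes cf: "claw_free (reduced_power_graph G)" and odd: "odd p"
    and xyw: "x \<in> carrier G" "y \<in> carrier G" "w \<in> carrier G"
    and x: "ord x = p ^ 2" and y: "y [^] p = \<one>" and w: "w [^] p = \<one>"
    and comm: "w \<otimes> x = x \<otimes> w" "w \<otimes> y = y \<otimes> w" "y \<otimes> x = w \<otimes> (x \<otimes> y)"
  shows "y \<in> generate G {x}"
proof (rule ccontr)
  assume no: "y \<notin> generate G {x}"
  define z where "z = x [^] p"
  have p0: "p > 1" by (rule prime_gt_1_nat[OF prime_p])
  have self: "a \<in> generate G {a}" for a by (auto intro: generate.incl)
  have z: "z \<in> carrier G" "ord z = p"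
    using xyw(1) x ord_power_prime_power[of x 2 1] by (auto simp: z_def)
  have "z \<noteq> \<one>" using z p0 by auto
  have "y \<noteq> \<one>" using no generate.one by metis
  then have ord_y: "ord y = p"
    using y xyw(2) prime_p by (metis ord_eq_1 pow_eq_id prime_nat_iff)
  have leaf: "ord a = p ^ 2" "z \<in> generate G {a}" if a: "a \<in> carrier G" "a [^] p = z" for a
  proof -
    obtain k where k: "ord a = p ^ k" using ord_eq_prime_power a(1) by blast
    have "k \<noteq> 0" using k a \<open>z \<noteq> \<one>\<close> by (metis nat_pow_one ord_eq_1 power_0)
    then have "ord z = p ^ (k - 1)" using ord_power_prime_power[of a k 1] a k by simp
    then have "p ^ (k - 1) = p ^ 1" using z by simp
    then have "k - 1 = 1" using p0 power_inject_exp by blast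
    then have "k = 2" by simp
    then show "ord a = p ^ 2" using k by simp
    show "z \<in> generate G {a}" using nat_pow_mem_generate[OF a(1) self, of p] a(2) by simp
  qed
  have xy: "x \<otimes> y \<in> carrier G" "(x \<otimes> y) [^] p = z"
    using nat_pow_odd_mult_twisted[OF xyw comm odd w] xyw y by (auto simp: z_def)
  have xyy: "x \<otimes> y [^] (2::nat) \<in> carrier G" "(x \<otimes> y [^] (2::nat)) [^] p = z"
  proof -
    have w2: "w [^] (2::nat) \<in> carrier G" and y2: "y [^] (2::nat) \<in> carrier G"
      using xyw by auto
    have "w [^] (2::nat) \<otimes> x = x \<otimes> w [^] (2::nat)"
      using group_commutes_pow[OF comm(1)] xyw by metis
    moreover have "w [^] (2::nat) \<otimes> y [^] (2::nat) = y [^] (2::nat) \<otimes> w [^] (2::nat)"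
      using group_commutes_pow comm(2) xyw by (metis nat_pow_closed)
    moreover have "y [^] (2::nat) \<otimes> x = w [^] (2::nat) \<otimes> (x \<otimes> y [^] (2::nat))"
      by (rule nat_pow_mult_twisted_commute[OF xyw comm(2,3)])
    moreover have "(a [^] (2::nat)) [^] p = \<one>" if "a \<in> carrier G" "a [^] p = \<one>" for a
      using that by (metis mult.commute nat_pow_one nat_pow_pow)
    ultimately have "(x \<otimes> y [^] (2::nat)) [^] p = x [^] p \<otimes> \<one>"
      using nat_pow_odd_mult_twisted[OF xyw(1) y2 w2 _ _ _ odd] xyw y w by metis
    then show "(x \<otimes> y [^] (2::nat)) [^] p = z" using xyw by (simp add: z_def)
  qed (use xyw in simp)
  have cancel: "b \<in> H" if "subgroup H G" "a \<in> H" "a \<otimes> b \<in> H" "b \<in> carrier G" for a b H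
    using that by (metis inv_solve_left' subgroup.m_closed subgroup.m_inv_closed subgroup.mem_carrier)
  have sub: "subgroup (generate G {a}) G" if "a \<in> carrier G" for a
    using that by (simp add: generate_is_subgroup)
  have lt: "ord z < ord x" using z x p0 by (simp add: power2_eq_square)
  consider "x \<otimes> y \<in> generate G {x}" | "x \<otimes> y [^] (2::nat) \<in> generate G {x}"
    | "x \<otimes> y [^] (2::nat) \<in> generate G {x \<otimes> y}"
    using claw_free_three[OF finite_carrier cf xyw(1) xy(1) xyy(1) _ _ z(1) \<open>z \<noteq> \<one>\<close> lt]
      leaf[OF xyw(1)] leaf[OF xy] leaf[OF xyy] x by (auto simp: z_def)
  then show False
  proof cases
    case 1
    then show False using cancel[OF sub self] xyw no by blast
  next
    case 2
    then have y2: "y [^] (2::nat) \<in> generate G {x}" using cancel[OF sub self] xyw by blast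
    \<comment> \<open>The order of \<open>y\<close> is odd, so \<open>y\<close> is a power of \<open>y\<^sup>2\<close>.\<close>
    have "y \<in> generate G {y [^] (2::nat)}" using mem_generate_square_if_odd_ord odd ord_y xyw by simp
    then show False using no generate_singleton_subset[OF xyw(1) y2] by blast
  next
    case 3
    have "x \<otimes> y [^] (2::nat) = (x \<otimes> y) \<otimes> y" using xyw by (simp add: m_assoc numeral_2_eq_2)
    then have yH: "y \<in> generate G {x \<otimes> y}"
      using 3 cancel[OF sub[OF xy(1)] self, of y] xyw by simp
    have "x \<otimes> y \<otimes> inv y \<in> generate G {x \<otimes> y}"
      using sub[OF xy(1)] self yH by (meson subgroup.m_closed subgroup.m_inv_closed)
    then have xH: "x \<in> generate G {x \<otimes> y}" using xyw by (simp add: m_assoc)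
    have "ord y dvd ord x" using ord_y x by simp
    then show False
      using ord_dvd_imp_mem_generate[OF xy(1) ord_nonzero[OF xy(1)] yH xH] no by blast
  qed
qed

text \<open>
  Let \<open>u\<close> have maximal order, which is at least \<open>p\<^sup>2\<close>. The subgroup of order \<open>p\<close> of \<open>\<langle>u\<rangle>\<close> is central:
  a central element of order \<open>p\<close> lies in it by the preceding lemma. Hence \<open>\<langle>u\<rangle>\<close> is normal, and the
  preceding lemma applies to every element of order \<open>p\<close>, which therefore lies in \<open>\<langle>u\<rangle>\<close> too.
  An arbitrary \<open>y\<close> follows by induction on its order: its \<open>p\<close>-th power is in \<open>\<langle>u\<rangle>\<close> and, since \<open>u\<close> has
  maximal order, is the \<open>p\<close>-th power of some \<open>h\<close> in \<open>\<langle>u\<rangle>\<close>; then \<open>h\<^sup>-\<^sup>1 y\<close> has trivial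
  \<open>p\<close>-th power.
\<close>

lemma claw_free_imp_cyclic:
  assumes cf: "claw_free (reduced_power_graph G)" and odd: "odd p"
    and v: "v \<in> carrier G" "v [^] p \<noteq> \<one>"
  shows "cyclic_group G"
proof -
  have p0: "p > 1" by (rule prime_gt_1_nat[OF prime_p])
  have self: "a \<in> generate G {a}" for a by (auto intro: generate.incl)
  have sub: "subgroup (generate G {a}) G" if "a \<in> carrier G" for a
    using that by (simp add: generate_is_subgroup)
  obtain u where u: "u \<in> carrier G" and max: "\<And>y. y \<in> carrier G \<Longrightarrow> ord y \<le> ord u"
  proof -
    have "Max (ord ` carrier G) \<in> ord ` carrier G"
      using v(1) finite_carrier by (intro Max_in) auto
    then obtain u where u: "u \<in> carrier G" "Max (ord ` carrier G) = ord u" by (elim imageE) simp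
    moreover have "ord y \<le> ord u" if "y \<in> carrier G" for y
      unfolding u(2)[symmetric] using that finite_carrier by (intro Max_ge) auto
    ultimately show ?thesis using that by blast
  qed
  obtain m where m: "ord u = p ^ m" using ord_eq_prime_power u by blast
  have exponent_le: "k \<le> m" if "y \<in> carrier G" "ord y = p ^ k" for y k
    using max[OF that(1)] that(2) m p0 by simp
  have m2: "m \<ge> 2"
  proof -
    obtain k where k: "ord v = p ^ k" using ord_eq_prime_power v(1) by blast
    have "\<not> ord v dvd p" using v by (simp add: pow_eq_id)
    then have "\<not> k \<le> 1" using k le_imp_power_dvd[of k 1 p] by auto
    then show ?thesis using exponent_le[OF v(1) k] by simp
  qed
  define x where "x = u [^] (p ^ (m - 2))"
  define z where "z = x [^] p"
  have x: "x \<in> carrier G" "ord x = p ^ 2" "x \<in> generate G {u}"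
    using u m m2 ord_power_prime_power[OF u m, of "m - 2"] nat_pow_mem_generate[OF u self]
    by (auto simp: x_def)
  have z: "z \<in> carrier G" "ord z = p" "z \<in> generate G {x}" "z \<in> generate G {u}"
    using x ord_power_prime_power[of x 2 1] nat_pow_mem_generate[OF x(1) self]
      nat_pow_mem_generate[OF u x(3)] by (auto simp: z_def)
  have z1: "z \<noteq> \<one>" using z p0 by auto
  have z_central: "\<forall>g\<in>carrier G. g \<otimes> z = z \<otimes> g"
  proof -
    have "carrier G \<noteq> {\<one>}" using z z1 by auto
    then obtain c where c: "c \<in> carrier G" "c \<noteq> \<one>" "\<forall>g\<in>carrier G. g \<otimes> c = c \<otimes> g"
      using exists_central_nontrivial by blast
    obtain k where k: "ord c = p ^ k" using ord_eq_prime_power c(1) by blast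
    have "k \<noteq> 0" using k c by (metis ord_eq_1 power_0)
    define d where "d = c [^] (p ^ (k - 1))"
    have d: "d \<in> carrier G" "ord d = p"
      using c(1) k \<open>k \<noteq> 0\<close> ord_power_prime_power[of c k "k - 1"] by (auto simp: d_def)
    have d_central: "\<forall>g\<in>carrier G. g \<otimes> d = d \<otimes> g"
      unfolding d_def
      by (rule central_generate[OF finite_carrier c(1,3) nat_pow_mem_generate[OF c(1) self]])
    have "d [^] p = \<one>" using d by (metis pow_ord_eq_1)
    then have "d \<in> generate G {x}"
      using order_p_mem_generate[OF cf odd x(1) d(1) one_closed x(2)] d d_central x(1) by simp
    then have "z \<in> generate G {d}"
      using ord_dvd_imp_mem_generate[OF x(1) ord_nonzero[OF x(1)] z(3)] z d by simp
    then show ?thesis using central_generate[OF finite_carrier d(1) d_central] by blast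
  qed
  have socle_central: "\<forall>g\<in>carrier G. g \<otimes> w = w \<otimes> g"
    if w: "w \<in> generate G {u}" "w [^] p = \<one>" for w
  proof -
    have "w \<in> carrier G" using subgroup.mem_carrier[OF sub[OF u] w(1)] .
    then have "ord w dvd ord z" using w z by (simp add: pow_eq_id)
    then have "w \<in> generate G {z}"
      using ord_dvd_imp_mem_generate[OF u ord_nonzero[OF u] w(1) z(4)] by blast
    then show ?thesis using central_generate[OF finite_carrier z(1) z_central] by blast
  qed
  have normal: "generate G {u} \<lhd> G"
  proof (rule normal_generate_if_claw_free[OF finite_carrier cf _ u z1 z(4) _ z_central])
    show "odd (order G)" using odd order_eq by simp
    have "p ^ 1 < p ^ m" using m2 p0 by (intro power_strict_increasing) auto
    then show "ord z < ord u" using z m by simp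
  qed
  \<comment> \<open>The commutator of \<open>y\<close> and \<open>k\<close> lies in \<open>\<langle>u\<rangle>\<close> by normality and, as \<open>y\<close> commutes with \<open>k\<^sup>p\<close>,
    has trivial \<open>p\<close>-th power. So it is central and the twisted power formula is available.\<close>
  have twist: "\<exists>w\<in>carrier G. w [^] p = \<one> \<and> (\<forall>g\<in>carrier G. g \<otimes> w = w \<otimes> g) \<and> y \<otimes> k = w \<otimes> (k \<otimes> y)"
    if y: "y \<in> carrier G" and k: "k \<in> generate G {u}" and yk: "y \<otimes> k [^] p = k [^] p \<otimes> y" for y k
  proof -
    have kG: "k \<in> carrier G" using subgroup.mem_carrier[OF sub[OF u] k] .
    have conj: "y \<otimes> k \<otimes> inv y \<in> generate G {u}" using normal.inv_op_closed2[OF normal y k] .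
    have inv: "inv k \<in> generate G {u}" using k sub[OF u] by (simp add: subgroup.m_inv_closed)
    define w where "w = (y \<otimes> k \<otimes> inv y) \<otimes> inv k"
    have w: "w \<in> generate G {u}" "w \<in> carrier G"
      using conj inv sub[OF u] y kG unfolding w_def by (auto simp: subgroup.m_closed)
    have "w [^] p = (y \<otimes> k \<otimes> inv y) [^] p \<otimes> (inv k) [^] p"
      unfolding w_def using y kG generate_singleton_commute[OF u conj inv]
      by (intro pow_mult_distrib) auto
    also have "\<dots> = y \<otimes> k [^] p \<otimes> inv y \<otimes> inv (k [^] p)"
      using y kG by (simp add: nat_pow_conj nat_pow_inv)
    also have "\<dots> = \<one>"
      unfolding yk using y kG by (simp add: m_assoc)
    finally have "w [^] p = \<one>" .
    moreover have "y \<otimes> k = w \<otimes> (k \<otimes> y)"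
    proof -
      have "inv k \<otimes> (k \<otimes> y) = y" using y kG by (simp flip: m_assoc)
      then show ?thesis unfolding w_def using y kG by (simp add: m_assoc)
    qed
    ultimately show ?thesis using w socle_central by blast
  qed
  have order_p: "y \<in> generate G {x}" if y: "y \<in> carrier G" "y [^] p = \<one>" for y
  proof -
    obtain w where "w \<in> carrier G" "w [^] p = \<one>" "\<forall>g\<in>carrier G. g \<otimes> w = w \<otimes> g"
      "y \<otimes> x = w \<otimes> (x \<otimes> y)"
      using twist[OF y(1) x(3)] z_central y(1) z_def by auto
    then show ?thesis
      using order_p_mem_generate[OF cf odd x(1) y(1) _ x(2) y(2)] x(1) y(1) by metis
  qed
  have all: "y \<in> generate G {u}" if "y \<in> carrier G" for y
    using that
  proof (induction "ord y" arbitrary: y rule: less_induct)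
    case less
    note y = \<open>y \<in> carrier G\<close>
    show ?case
    proof (cases "y = \<one>")
      case False
      obtain k where k: "ord y = p ^ k" using ord_eq_prime_power y by blast
      have "k \<noteq> 0" using k y False by (metis ord_eq_1 power_0)
      \<comment> \<open>Maximality of the order of \<open>u\<close> enters here: it puts \<open>y\<^sup>p\<close> among the \<open>p\<close>-th powers of \<open>\<langle>u\<rangle>\<close>.\<close>
      have "k \<le> m" using exponent_le[OF y k] .
      have yp: "y [^] p \<in> carrier G" "ord (y [^] p) = p ^ (k - 1)"
        using y k \<open>k \<noteq> 0\<close> ord_power_prime_power[of y k 1] by auto
      have up: "u [^] p \<in> carrier G" "ord (u [^] p) = p ^ (m - 1)"
        using u m m2 ord_power_prime_power[of u m 1] by auto
      have "ord (y [^] p) < ord y" using yp k \<open>k \<noteq> 0\<close> p0 by simp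
      then have "y [^] p \<in> generate G {u}" using less.hyps yp(1) by blast
      moreover have "u [^] p \<in> generate G {u}" using nat_pow_mem_generate[OF u self] .
      moreover have "ord (y [^] p) dvd ord (u [^] p)"
        using yp up \<open>k \<le> m\<close> by (simp add: le_imp_power_dvd)
      ultimately have "y [^] p \<in> generate G {u [^] p}"
        using ord_dvd_imp_mem_generate[OF u ord_nonzero[OF u]] by blast
      then obtain i :: nat where i: "y [^] p = (u [^] p) [^] i"
        using generate_pow_on_finite_carrier[OF finite_carrier up(1)] by auto
      define h where "h = u [^] i"
      have h: "h \<in> generate G {u}" "h \<in> carrier G" and hp: "h [^] p = y [^] p"
        using nat_pow_mem_generate[OF u self] u i by (auto simp: h_def nat_pow_pow mult.commute)
      have ih: "inv h \<in> generate G {u}" using h sub[OF u] by (simp add: subgroup.m_inv_closed)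
      have ihp: "inv h [^] p = inv (y [^] p)" using h hp by (simp add: nat_pow_inv)
      \<comment> \<open>The commutator of \<open>y\<close> with \<open>h\<^sup>-\<^sup>1\<close> is under control because \<open>h\<^sup>p = y\<^sup>p\<close> commutes with \<open>y\<close>.\<close>
      have "y \<otimes> inv (y [^] p) = inv (y [^] p) \<otimes> y"
        using y by (metis group_commutes_pow inv_closed l_inv nat_pow_inv r_inv)
      then obtain w where w: "w \<in> carrier G" "w [^] p = \<one>" "\<forall>g\<in>carrier G. g \<otimes> w = w \<otimes> g"
        "y \<otimes> inv h = w \<otimes> (inv h \<otimes> y)"
        using twist[OF y ih] ihp by auto
      then have "(inv h \<otimes> y) [^] p = inv h [^] p \<otimes> y [^] p"
        using h y by (intro nat_pow_odd_mult_twisted[of _ _ w] odd) auto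
      also have "\<dots> = \<one>" using ihp y by simp
      finally have "inv h \<otimes> y \<in> generate G {x}" using order_p h y by simp
      then have "inv h \<otimes> y \<in> generate G {u}" using generate_singleton_subset[OF u x(3)] by blast
      then have "h \<otimes> (inv h \<otimes> y) \<in> generate G {u}" by (rule subgroup.m_closed[OF sub[OF u] h(1)])
      then show ?thesis using h y by (simp flip: m_assoc)
    qed (simp add: generate.one)
  qed
  then have "carrier G = range (\<lambda>k::int. u [^] k)"
    using u generate_pow[OF u] by auto
  then show ?thesis using u cyclic_group by blast
qed

end

section \<open>Cyclic groups and groups of prime exponent\<close>

context finite_p_group begin

text \<open>
  The subgroups of a cyclic \<open>p\<close>-group form a chain, so any two vertices in it are adjacent. Both
  kinds of claw-free groups satisfy the hypothesis: in a cyclic group \<open>g\<close> is a generator, and in a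
  group of exponent \<open>p\<close> it can be taken to be \<open>a\<close> itself.
\<close>

lemma claw_free_if_neighbours_in_cyclic:
  assumes "\<And>a. a \<in> carrier G \<Longrightarrow> \<exists>g\<in>carrier G. \<forall>v. a \<rightarrow>\<^bsub>reduced_power_graph G\<^esub> v \<longrightarrow> v \<in> generate G {g}"
  shows "claw_free (reduced_power_graph G)"
  unfolding claw_free_iff[OF graph_reduced_power_graph[OF finite_carrier]]
proof (intro allI impI, elim conjE)
  fix a V assume V: "card V = 3" "\<forall>v\<in>V. a \<rightarrow>\<^bsub>reduced_power_graph G\<^esub> v"
  obtain u v where uv: "u \<in> V" "v \<in> V" "u \<noteq> v"
    using V(1) by (auto simp: card_3_iff)
  then have adj: "a \<rightarrow>\<^bsub>reduced_power_graph G\<^esub> u" "a \<rightarrow>\<^bsub>reduced_power_graph G\<^esub> v" using V(2) by auto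
  then have G: "a \<in> carrier G" "u \<in> carrier G - {\<one>}" "v \<in> carrier G - {\<one>}"
    unfolding reduced_power_graph_adjacent_iff by blast+
  obtain g where g: "g \<in> carrier G" "u \<in> generate G {g}" "v \<in> generate G {g}"
    using assms[OF G(1)] adj by blast
  have "ord u dvd ord v \<or> ord v dvd ord u" using ord_dvd_linear G by blast
  then have "u \<in> generate G {v} \<or> v \<in> generate G {u}"
    using ord_dvd_imp_mem_generate[OF g(1) ord_nonzero[OF g(1)]] g(2,3) by blast
  then have "u \<rightarrow>\<^bsub>reduced_power_graph G\<^esub> v"
    using uv(3) G unfolding reduced_power_graph_adjacent_iff by blast
  then show "\<exists>u\<in>V. \<exists>v\<in>V. u \<rightarrow>\<^bsub>reduced_power_graph G\<^esub> v" using uv by blast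
qed

lemma claw_free_if_cyclic:
  assumes "cyclic_group G"
  shows "claw_free (reduced_power_graph G)"
proof (rule claw_free_if_neighbours_in_cyclic)
  obtain g where "g \<in> carrier G" "carrier G = range (\<lambda>k::int. g [^] k)"
    using assms unfolding cyclic_group by blast
  then have g: "g \<in> carrier G" "carrier G = generate G {g}"
    using generate_pow[of g] by auto
  fix a assume "a \<in> carrier G"
  show "\<exists>g\<in>carrier G. \<forall>v. a \<rightarrow>\<^bsub>reduced_power_graph G\<^esub> v \<longrightarrow> v \<in> generate G {g}"
    using g by (intro bexI[of _ g]) (auto simp: reduced_power_graph_adjacent_iff)
qed

lemma claw_free_if_pow_prime_eq_one:
  assumes "\<forall>x\<in>carrier G. x [^] p = \<one>"
  shows "claw_free (reduced_power_graph G)"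
proof (rule claw_free_if_neighbours_in_cyclic)
  have ord: "ord x = p" if "x \<in> carrier G - {\<one>}" for x
    using that assms prime_p by (metis DiffE insertI1 ord_eq_1 pow_eq_id prime_nat_iff)
  fix a assume a: "a \<in> carrier G"
  have "v \<in> generate G {a}" if "a \<rightarrow>\<^bsub>reduced_power_graph G\<^esub> v" for v
  proof -
    have "a \<in> carrier G - {\<one>}" "v \<in> carrier G - {\<one>}" "v \<in> generate G {a} \<or> a \<in> generate G {v}"
      using that unfolding reduced_power_graph_adjacent_iff by blast+
    then show ?thesis using generate_singleton_sym[OF finite_carrier, of v a] ord by auto
  qed
  then show "\<exists>g\<in>carrier G. \<forall>v. a \<rightarrow>\<^bsub>reduced_power_graph G\<^esub> v \<longrightarrow> v \<in> generate G {g}"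
    using a by blast
qed

text \<open>
  The trivial group has exponent \<open>1\<close>, hence the first conjunct.
\<close>

lemma group_exponent_eq_prime_iff:
  "group_exponent G = p \<longleftrightarrow> carrier G \<noteq> {\<one>} \<and> (\<forall>x\<in>carrier G. x [^] p = \<one>)"
proof
  let ?P = "\<lambda>k::nat. 0 < k \<and> (\<forall>x\<in>carrier G. x [^] k = \<one>)"
  have p0: "p > 1" by (rule prime_gt_1_nat[OF prime_p])
  {
    assume exp: "group_exponent G = p"
    then have ex: "\<exists>k. ?P k" and least: "p = (LEAST k. ?P k)"
      using p0 unfolding group_exponent_def by (auto split: if_splits)
    have "?P p" unfolding least using ex by (rule LeastI_ex)
    moreover have "carrier G \<noteq> {\<one>}"
    proof
      assume "carrier G = {\<one>}"
      then have "?P 1" by simp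
      then have "p \<le> 1" unfolding least by (rule Least_le)
      then show False using p0 by simp
    qed
    ultimately show "carrier G \<noteq> {\<one>} \<and> (\<forall>x\<in>carrier G. x [^] p = \<one>)" by blast
  next
    assume R: "carrier G \<noteq> {\<one>} \<and> (\<forall>x\<in>carrier G. x [^] p = \<one>)"
    then obtain x where x: "x \<in> carrier G" "x \<noteq> \<one>" by blast
    then have ord_x: "ord x = p"
      using R prime_p by (metis ord_eq_1 pow_eq_id prime_nat_iff)
    have P: "?P p" using R p0 by simp
    have "(LEAST k. ?P k) = p"
    proof (rule Least_equality)
      fix k assume "?P k"
      then have "p dvd k" using x ord_x by (metis pow_eq_id)
      then show "p \<le> k" using \<open>?P k\<close> by (simp add: dvd_imp_le)
    qed (rule P)
    then show "group_exponent G = p" using P unfolding group_exponent_def by auto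
  }
qed

end

section \<open>Characterization of claw-free reduced power graphs\<close>

theorem proposition2p6:
  fixes G :: "('a, 'm) monoid_scheme" and p n :: nat
  assumes "prime p" and "odd p"
    and "group G" and "finite (carrier G)" and "order G = p ^ n"
  shows "claw_free (reduced_power_graph G) \<longleftrightarrow> cyclic_group G \<or> group_exponent G = p"
proof -
  interpret finite_p_group G p n
    using assms by (simp add: finite_p_group_def finite_p_group_axioms_def)
  show ?thesis
  proof
    assume cf: "claw_free (reduced_power_graph G)"
    show "cyclic_group G \<or> group_exponent G = p"
    proof (cases "\<forall>x\<in>carrier G. x [^]\<^bsub>G\<^esub> p = \<one>\<^bsub>G\<^esub>")
      case True
      show ?thesis
      proof (cases "carrier G = {\<one>\<^bsub>G\<^esub>}")
        case True
        then have "trivial_group G" using trivial_group by blast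
        then show ?thesis using trivial_imp_cyclic_group by blast
      next
        case False
        then show ?thesis using True group_exponent_eq_prime_iff by blast
      qed
    next
      case False
      then show ?thesis using claw_free_imp_cyclic[OF cf \<open>odd p\<close>] by blast
    qed
  next
    assume "cyclic_group G \<or> group_exponent G = p"
    then show "claw_free (reduced_power_graph G)"
      using claw_free_if_cyclic claw_free_if_pow_prime_eq_one group_exponent_eq_prime_iff by blast
  qed
qed

end
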